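(* There is a function $\varepsilon:\mathbb{N}\to\mathbb{R}$ with $\varepsilon(k) \to 0$ as $k \to \infty$ such that for all integers $k \ge 1$ and $n \ge k$, \[\operatorname{sat}(Q_n, S_k) \le (k - 2 + \varepsilon(k))\, 2^{n-1}.\]
   Context: $Q_n$ is the $n$-dimensional hypercube: vertex set $\{0,1\}^n$, two vertices adjacent iff they differ in exactly one coordinate. $S_k$ is the star $K_{1,k}$ (one central vertex joined to $k$ leaves). For a graph $G$, a subgraph $H'$ of $Q_n$ is $(Q_n,G)$-saturated if it contains no subgraph isomorphic to $G$ but adding any edge of $Q_n$ not in $H'$ creates a subgraph isomorphic to $G$; $\operatorname{sat}(Q_n,G)$ is the minimum number of edges of such a subgraph. *)

theory Defs
  imports Complex_Main "HOL-Library.FuncSet"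
begin

record 'a graph =
  verts :: "'a set"
  edges :: "'a set set"

definition simple_graph :: "'a graph \<Rightarrow> bool" where
  "simple_graph G \<longleftrightarrow> (\<forall>e\<in>edges G. e \<subseteq> verts G \<and> card e = 2)"

definition subgraph :: "'a graph \<Rightarrow> 'a graph \<Rightarrow> bool" where
  "subgraph K H \<longleftrightarrow> simple_graph K \<and> verts K \<subseteq> verts H \<and> edges K \<subseteq> edges H"

definition isomorphic :: "'a graph \<Rightarrow> 'b graph \<Rightarrow> bool" where
  "isomorphic G K \<longleftrightarrow>
     (\<exists>f. bij_betw f (verts G) (verts K) \<and> (\<lambda>e. f ` e) ` edges G = edges K)"

definition contains_copy :: "'a graph \<Rightarrow> 'b graph \<Rightarrow> bool" where
  "contains_copy H G \<longleftrightarrow> (\<exists>K. subgraph K H \<and> isomorphic G K)"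

text \<open>A subgraph need not be spanning, so adding an edge also adds those of its endpoints
  that are missing.\<close>

definition add_edge :: "'a set \<Rightarrow> 'a graph \<Rightarrow> 'a graph" where
  "add_edge e K = \<lparr>verts = verts K \<union> e, edges = insert e (edges K)\<rparr>"

definition saturated :: "'a graph \<Rightarrow> 'b graph \<Rightarrow> 'a graph \<Rightarrow> bool" where
  "saturated H G K \<longleftrightarrow>
     subgraph K H \<and> \<not> contains_copy K G \<and>
     (\<forall>e\<in>edges H - edges K. contains_copy (add_edge e K) G)"

definition sat :: "'a graph \<Rightarrow> 'b graph \<Rightarrow> nat" where
  "sat H G = (LEAST m. \<exists>K. saturated H G K \<and> m = card (edges K))"

definition hypercube :: "nat \<Rightarrow> (nat \<Rightarrow> nat) graph" where
  "hypercube n =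
     \<lparr>verts = {..<n} \<rightarrow>\<^sub>E {0, 1},
      edges = {{x, y} |x y. x \<in> {..<n} \<rightarrow>\<^sub>E {0, 1} \<and> y \<in> {..<n} \<rightarrow>\<^sub>E {0, 1} \<and>
                            card {i. i < n \<and> x i \<noteq> y i} = 1}\<rparr>"

definition star :: "nat \<Rightarrow> nat graph" where
  "star k = \<lparr>verts = {0..k}, edges = {{0, i} |i. i \<in> {1..k}}\<rparr>"

text \<open>The minimum in \<^const>\<open>sat\<close> ranges over a nonempty set as soon as the host
  is finite and \<open>G\<close> has an edge, which is the case for hypercubes and stars
  with at least one leaf; so it is attained there.\<close>

lemma saturated_exists:
  assumes H: "simple_graph H" and fin: "finite (edges H)" and G: "edges G \<noteq> {}"
  shows "\<exists>K. saturated H G K"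
proof -
  define P where "P E \<longleftrightarrow> E \<subseteq> edges H \<and> \<not> contains_copy \<lparr>verts = verts H, edges = E\<rparr> G" for E
  have "P {}"
    using G by (auto simp: P_def contains_copy_def subgraph_def isomorphic_def)
  moreover have "\<forall>E. P E \<longrightarrow> card E < Suc (card (edges H))"
    using fin by (auto simp: P_def less_Suc_eq_le intro: card_mono)
  ultimately obtain E where E: "P E" and max: "\<And>F. P F \<Longrightarrow> card F \<le> card E"
    using ex_has_greatest_nat[of P "{}" card "Suc (card (edges H))"] by metis
  define K where "K = \<lparr>verts = verts H, edges = E\<rparr>"
  have "contains_copy (add_edge e K) G" if e: "e \<in> edges H" "e \<notin> E" for e
  proof (rule ccontr)
    assume *: "\<not> contains_copy (add_edge e K) G"
    have "verts H \<union> e = verts H"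
      using H e by (auto simp: simple_graph_def)
    then have "P (insert e E)"
      using * e E by (auto simp: P_def K_def add_edge_def)
    moreover have "finite E"
      using E fin by (auto simp: P_def intro: finite_subset)
    ultimately show False
      using max[of "insert e E"] e by simp
  qed
  moreover have "subgraph K H" "\<not> contains_copy K G"
    using E H by (auto simp: P_def K_def subgraph_def simple_graph_def)
  ultimately have "saturated H G K"
    by (auto simp: saturated_def K_def)
  then show ?thesis ..
qed

lemma simple_graph_hypercube: "simple_graph (hypercube n)"
  unfolding simple_graph_def
proof
  fix e assume "e \<in> edges (hypercube n)"
  then obtain x y where e: "e = {x, y}" and V: "x \<in> verts (hypercube n)" "y \<in> verts (hypercube n)"
    and d: "card {i. i < n \<and> x i \<noteq> y i} = 1"
    unfolding hypercube_def graph.simps by blast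
  from d have "x \<noteq> y"
    by (metis (mono_tags, lifting) card.empty empty_Collect_eq zero_neq_one)
  with e V show "e \<subseteq> verts (hypercube n) \<and> card e = 2"
    by simp
qed

lemma simple_graph_star: "simple_graph (star k)"
  by (auto simp: simple_graph_def star_def card_insert_if)

lemma finite_edges_hypercube: "finite (edges (hypercube n))"
proof (rule finite_subset)
  show "edges (hypercube n) \<subseteq> Pow (verts (hypercube n))"
    using simple_graph_hypercube[of n] unfolding simple_graph_def by blast
  show "finite (Pow (verts (hypercube n)))"
    by (simp add: hypercube_def finite_PiE)
qed

lemma sat_hypercube_star_attained:
  assumes "k \<ge> 1"
  shows "\<exists>K. saturated (hypercube n) (star k) K \<and> card (edges K) = sat (hypercube n) (star k)"
proof -
  have "edges (star k) \<noteq> {}"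
    using assms by (auto simp: star_def)
  then obtain K where "saturated (hypercube n) (star k) K"
    using saturated_exists[OF simple_graph_hypercube finite_edges_hypercube] by metis
  then have "\<exists>m K. saturated (hypercube n) (star k) K \<and> m = card (edges K)"
    by blast
  from LeastI_ex[OF this] show ?thesis
    unfolding sat_def by metis
qed

end

theory Submission
  imports Defs
begin

text \<open>Within the first \<open>k\<close> coordinates, delete from the hypercube a family of vertex-disjoint stars
  covering all vertices: every vertex then has degree at most \<open>k - 1\<close>, with equality at the leaves of
  the deleted stars. Taking as centres the zero set of a Hamming syndrome on \<open>m = 2 ^ r - 1 \<le> k\<close>
  coordinates makes the number of stars \<open>2 ^ n / 2 ^ r\<close>, a negligible proportion. All edges in the
  directions \<open>i \<ge> k\<close> are deleted too; letting these coordinates contribute a nonzero column to the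
  syndrome keeps the set of centres independent in the whole hypercube, so each deleted edge has an
  endpoint of degree \<open>k - 1\<close>.\<close>

section \<open>Stars and neighbourhoods\<close>

definition neighbours :: "'a graph \<Rightarrow> 'a \<Rightarrow> 'a set" where
  "neighbours G x = {y. {x, y} \<in> edges G}"

lemma not_in_neighbours_self:
  assumes "simple_graph G"
  shows "x \<notin> neighbours G x"
  using assms by (auto simp: simple_graph_def neighbours_def)

lemma neighbours_subset_verts:
  assumes "simple_graph G"
  shows "neighbours G x \<subseteq> verts G"
  using assms by (auto simp: simple_graph_def neighbours_def)

text \<open>The images of the leaves are \<open>k\<close> distinct neighbours of the image of the
  centre. Finiteness matters because \<open>card\<close> is 0 on infinite sets.\<close>

lemma contains_star_imp_degree:
  assumes copy: "contains_copy G (star k)" and fin: "finite (verts G)" and G: "simple_graph G"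
  shows "\<exists>x\<in>verts G. k \<le> card (neighbours G x)"
proof -
  obtain K f where K: "subgraph K G" and f: "bij_betw f {0..k} (verts K)"
    and e: "(\<lambda>e. f ` e) ` edges (star k) = edges K"
    using copy by (auto simp: contains_copy_def isomorphic_def star_def)
  have "f ` {1..k} \<subseteq> neighbours G (f 0)"
  proof (clarify)
    fix i assume "i \<in> {1..k}"
    then have "{0, i} \<in> edges (star k)"
      by (auto simp: star_def)
    then have "f ` {0, i} \<in> edges K"
      using e by blast
    then show "f i \<in> neighbours G (f 0)"
      using K by (auto simp: subgraph_def neighbours_def)
  qed
  moreover have "finite (neighbours G (f 0))"
    using neighbours_subset_verts[OF G] fin by (rule finite_subset)
  moreover have "inj_on f {1..k}"
    using f by (auto simp: bij_betw_def intro: inj_on_subset)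
  ultimately have "k \<le> card (neighbours G (f 0))"
    using card_mono[of "neighbours G (f 0)" "f ` {1..k}"] by (simp add: card_image)
  moreover have "f 0 \<in> verts G"
    using f K by (auto simp: bij_betw_def subgraph_def)
  ultimately show ?thesis by blast
qed

text \<open>Copies need not be induced, so any \<open>k\<close> neighbours of \<open>c\<close> serve
  as leaves.\<close>

lemma contains_star_if_degree:
  assumes G: "simple_graph G" and c: "c \<in> verts G" and k: "k \<le> card (neighbours G c)"
  shows "contains_copy G (star k)"
proof -
  obtain W where W: "W \<subseteq> neighbours G c" "card W = k" "finite W"
    using obtain_subset_with_card_n[OF k] by metis
  obtain g where g: "bij_betw g {1..k} W"
    using W finite_same_card_bij[of "{1..k}" W] by auto
  define K where "K = \<lparr>verts = insert c W, edges = (\<lambda>y. {c, y}) ` W\<rparr>"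
  have cW: "c \<notin> W"
    using W(1) not_in_neighbours_self[OF G] by blast
  \<comment> \<open>The update at 0, which maps the centre to \<open>c\<close>, does not affect the
    leaves \<open>{1..k}\<close>.\<close>
  have "bij_betw (g(0 := c)) {1..k} W"
    using g by (subst bij_betw_cong[of _ _ g]) auto
  then have "bij_betw (g(0 := c)) (insert 0 {1..k}) (insert c W)"
    using cW notIn_Un_bij_betw[of 0 "{1..k}" "g(0 := c)" W] by auto
  moreover have "insert 0 {1..k} = {0..k}"
    by auto
  ultimately have "bij_betw (g(0 := c)) (verts (star k)) (verts K)"
    by (simp add: star_def K_def)
  moreover have "(\<lambda>e. (g(0 := c)) ` e) ` edges (star k) = edges K"
  proof -
    have "edges (star k) = (\<lambda>i. {0, i}) ` {1..k}"
      by (auto simp: star_def)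
    then have "(\<lambda>e. (g(0 := c)) ` e) ` edges (star k) = (\<lambda>i. {c, g i}) ` {1..k}"
      by (auto simp: image_image intro!: image_cong)
    also have "\<dots> = (\<lambda>y. {c, y}) ` (g ` {1..k})"
      by (simp add: image_image)
    finally show ?thesis
      using g by (simp add: bij_betw_def K_def)
  qed
  ultimately have "isomorphic (star k) K"
    unfolding isomorphic_def by blast
  moreover have "subgraph K G"
    using W(1) c cW neighbours_subset_verts[OF G, of c]
    by (auto simp: subgraph_def simple_graph_def K_def neighbours_def card_insert_if)
  ultimately show ?thesis
    by (auto simp: contains_copy_def)
qed

text \<open>Double counting of incident vertex-edge pairs; \<open>y\<close> corresponds to the edge
  \<open>{x, y}\<close> at \<open>x\<close>.\<close>

lemma handshake:
  assumes G: "simple_graph G" and fin: "finite (verts G)"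
  shows "(\<Sum>x\<in>verts G. card (neighbours G x)) = 2 * card (edges G)"
proof -
  have sub: "edges G \<subseteq> Pow (verts G)"
    using G by (auto simp: simple_graph_def)
  then have finE: "finite (edges G)"
    using fin by (auto intro: finite_subset)
  have "card (neighbours G x) = card {e \<in> edges G. x \<in> e}" for x
  proof (rule bij_betw_same_card[of "\<lambda>y. {x, y}"])
    have "e \<in> (\<lambda>y. {x, y}) ` neighbours G x" if "e \<in> edges G" "x \<in> e" for e
    proof -
      have "card e = 2"
        using G that by (auto simp: simple_graph_def)
      then obtain y where "e = {x, y}"
        using \<open>x \<in> e\<close> by (auto simp: card_2_iff)
      with that show ?thesis
        by (auto simp: neighbours_def)
    qed
    then show "bij_betw (\<lambda>y. {x, y}) (neighbours G x) {e \<in> edges G. x \<in> e}"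
      by (auto simp: bij_betw_def inj_on_def neighbours_def doubleton_eq_iff)
  qed
  then have "(\<Sum>x\<in>verts G. card (neighbours G x)) = (\<Sum>x\<in>verts G. card {e \<in> edges G. x \<in> e})"
    by simp
  also have "\<dots> = 2 * card (edges G)"
  proof (rule sum_multicount[OF fin finE])
    show "\<forall>e\<in>edges G. card {x \<in> verts G. x \<in> e} = 2"
    proof
      fix e assume "e \<in> edges G"
      then have "{x \<in> verts G. x \<in> e} = e" "card e = 2"
        using G by (auto simp: simple_graph_def)
      then show "card {x \<in> verts G. x \<in> e} = 2"
        by simp
    qed
  qed
  finally show ?thesis .
qed

lemma sat_le:
  assumes "saturated H G K"
  shows "sat H G \<le> card (edges K)"
  unfolding sat_def using assms by (intro Least_le) blast

section \<open>Hypercubes\<close>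

text \<open>Truncated subtraction swaps 0 and 1 but sends larger values to 0, so
  \<open>flip i\<close> is inverted by itself only where the coordinate is a bit.\<close>

definition flip :: "nat \<Rightarrow> (nat \<Rightarrow> nat) \<Rightarrow> nat \<Rightarrow> nat" where
  "flip i x = x(i := 1 - x i)"

definition cube :: "nat \<Rightarrow> (nat \<Rightarrow> nat) set" where
  "cube n = {..<n} \<rightarrow>\<^sub>E {0, 1}"

lemma cube_coord: "x \<in> cube n \<Longrightarrow> i < n \<Longrightarrow> x i = 0 \<or> x i = 1"
  by (auto simp: cube_def dest: PiE_mem)

lemma cube_outside: "x \<in> cube n \<Longrightarrow> \<not> i < n \<Longrightarrow> x i = undefined"
  unfolding cube_def by (erule PiE_arb) simp

lemma flip_in_cube: "x \<in> cube n \<Longrightarrow> i < n \<Longrightarrow> flip i x \<in> cube n"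
  by (auto simp: cube_def flip_def PiE_iff extensional_def)

lemma flip_flip: "x \<in> cube n \<Longrightarrow> i < n \<Longrightarrow> flip i (flip i x) = x"
  using cube_coord[of x n i] by (auto simp: flip_def fun_eq_iff)

lemma flip_eq_iff: "x \<in> cube n \<Longrightarrow> i < n \<Longrightarrow> x j = flip i x j \<longleftrightarrow> j \<noteq> i"
  using cube_coord[of x n i] by (auto simp: flip_def)

lemma flip_inject:
  assumes "x \<in> cube n" "i < n" "j < n"
  shows "flip i x = flip j x \<longleftrightarrow> i = j"
  using assms flip_eq_iff by metis

lemma finite_cube: "finite (cube n)"
  by (simp add: cube_def finite_PiE)

lemma card_cube: "card (cube n) = 2 ^ n"
  by (simp add: cube_def card_PiE numeral_2_eq_2)

lemma edges_hypercube: "edges (hypercube n) = {{x, flip i x} |x i. x \<in> cube n \<and> i < n}"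
proof (intro equalityI subsetI)
  fix e assume "e \<in> edges (hypercube n)"
  then obtain x y where e: "e = {x, y}" and x: "x \<in> cube n" and y: "y \<in> cube n"
    and "card {i. i < n \<and> x i \<noteq> y i} = 1"
    unfolding hypercube_def graph.simps cube_def by blast
  then obtain i where "{i. i < n \<and> x i \<noteq> y i} = {i}"
    by (auto simp: card_1_singleton_iff)
  then have i: "j < n \<and> x j \<noteq> y j \<longleftrightarrow> j = i" for j
    by blast
  then have "i < n" "x i \<noteq> y i"
    by blast+
  have "y j = flip i x j" for j
  proof (cases "j = i")
    case True
    then show ?thesis
      using \<open>x i \<noteq> y i\<close> cube_coord[OF x \<open>i < n\<close>] cube_coord[OF y \<open>i < n\<close>] by (auto simp: flip_def)
  next
    case False
    have "y j = x j"
    proof (cases "j < n")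
      case True
      then show ?thesis
        using i[of j] False by metis
    next
      case False
      \<comment> \<open>Off the index set both points take the value
        \<open>undefined\<close>.\<close>
      then show ?thesis
        using cube_outside[OF x] cube_outside[OF y] by simp
    qed
    then show ?thesis
      using False by (simp add: flip_def)
  qed
  then have "y = flip i x" ..
  then show "e \<in> {{x, flip i x} |x i. x \<in> cube n \<and> i < n}"
    using e x \<open>i < n\<close> by blast
next
  fix e assume "e \<in> {{x, flip i x} |x i. x \<in> cube n \<and> i < n}"
  then obtain x i where e: "e = {x, flip i x}" and x: "x \<in> cube n" and i: "i < n"
    by blast
  have "{j. j < n \<and> x j \<noteq> flip i x j} = {i}"
    using i by (auto simp: flip_eq_iff[OF x i])
  then have "card {j. j < n \<and> x j \<noteq> flip i x j} = 1"
    by simp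
  then show "e \<in> edges (hypercube n)"
    using e x flip_in_cube[OF x i] unfolding hypercube_def graph.simps cube_def by blast
qed

section \<open>Hamming syndromes\<close>

unbundle bit_operations_syntax

text \<open>Columns of a parity-check matrix, with vectors over GF(2) encoded as binary numbers. The
  first \<open>2 ^ r - 1\<close> columns are all the nonzero \<open>r\<close>-bit vectors, each
  once; later ones repeat the nonzero vector 1.\<close>

definition column :: "nat \<Rightarrow> nat \<Rightarrow> nat" where
  "column r i = (if i < 2 ^ r - 1 then i + 1 else 1)"

text \<open>Matrix-vector product over GF(2): \<open>XOR\<close> is vector addition, and the bit
  \<open>x n\<close> selects or drops its column.\<close>

primrec syndrome :: "nat \<Rightarrow> nat \<Rightarrow> (nat \<Rightarrow> nat) \<Rightarrow> nat" where
  "syndrome r 0 x = 0"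
| "syndrome r (Suc n) x = syndrome r n x XOR (x n * column r n)"

lemma xor_nat_less_power:
  fixes a b :: nat
  assumes "a < 2 ^ r" "b < 2 ^ r"
  shows "a XOR b < 2 ^ r"
  \<comment> \<open>Numbers below \<open>2 ^ r\<close> are those fixed by \<open>take_bit r\<close>,
    which commutes with \<open>XOR\<close>.\<close>
  using assms by (metis take_bit_nat_eq_self_iff take_bit_xor)

lemma column_less:
  assumes "r \<ge> 1"
  shows "column r i < 2 ^ r"
  using assms one_less_power[of "2 :: nat" r] by (auto simp: column_def)

lemma column_neq_0: "column r i \<noteq> 0"
  by (simp add: column_def)

lemma syndrome_less:
  assumes "r \<ge> 1" "x \<in> cube n"
  shows "syndrome r n x < 2 ^ r"
proof -
  \<comment> \<open>Induction on prefixes keeps \<open>x\<close> fixed, since a point of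
    \<open>cube n\<close> is not a point of a smaller cube.\<close>
  have "l \<le> n \<Longrightarrow> syndrome r l x < 2 ^ r" for l
  proof (induction l)
    case (Suc l)
    moreover have "x l * column r l < 2 ^ r"
      using cube_coord[OF assms(2), of l] Suc.prems column_less[OF assms(1), of l] by auto
    ultimately show ?case
      by (simp add: xor_nat_less_power)
  qed simp
  then show ?thesis by simp
qed

text \<open>Linearity: changing one bit adds its column. If the bit was 1, the added copy cancels
  the one already present.\<close>

lemma syndrome_flip:
  assumes "x \<in> cube n" "i < n"
  shows "syndrome r n (flip i x) = syndrome r n x XOR column r i"
proof -
  have *: "syndrome r l (flip i x) = syndrome r l x" if "l \<le> i" for l
    using that by (induction l) (auto simp: flip_def)
  have "syndrome r l (flip i x) = syndrome r l x XOR column r i" if "i < l" for l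
    using that
  proof (induction l)
    case (Suc l)
    show ?case
    proof (cases "i = l")
      case True
      then have "flip i x l = 1 - x l"
        by (simp add: flip_def)
      then show ?thesis
        using True *[of l] cube_coord[OF assms] by (auto simp: xor.assoc)
    next
      case False
      then have "flip i x l = x l"
        by (simp add: flip_def)
      then show ?thesis
        using Suc False by (simp add: ac_simps)
    qed
  qed simp
  then show ?thesis
    using assms by simp
qed

lemma xor_nat_eq_0_iff: "a XOR b = 0 \<longleftrightarrow> a = b" for a b :: nat
  by (metis xor.assoc xor.right_neutral xor_self_eq xor.left_neutral)

lemma syndrome_flip_eq_0_iff:
  assumes "x \<in> cube n" "i < n"
  shows "syndrome r n (flip i x) = 0 \<longleftrightarrow> syndrome r n x = column r i"
  by (simp add: syndrome_flip[OF assms] xor_nat_eq_0_iff)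

text \<open>The Hamming code is perfect: each vertex arises exactly once from a codeword by staying
  put or flipping one of the first \<open>2 ^ r - 1\<close> coordinates.\<close>

lemma card_code:
  assumes r: "r \<ge> 1" and n: "2 ^ r - 1 \<le> n"
  shows "2 ^ r * card {x \<in> cube n. syndrome r n x = 0} = 2 ^ n"
proof -
  define C where "C = {x \<in> cube n. syndrome r n x = 0}"
  \<comment> \<open>Direction \<open>s - 1\<close> carries column \<open>s\<close>, so
    \<open>t s\<close> adds \<open>s\<close> to the syndrome; \<open>s = 0\<close> means no
    move.\<close>
  define t where "t s x = (if s = 0 then x else flip (s - 1) x)" for s x
  have col: "column r (s - 1) = s" if "s < 2 ^ r" "s \<noteq> 0" for s
    using that by (auto simp: column_def)
  have t: "t s x \<in> cube n" "t s (t s x) = x" "syndrome r n (t s x) = syndrome r n x XOR s"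
    if "s < 2 ^ r" "x \<in> cube n" for s x
  proof -
    have s: "s \<noteq> 0 \<Longrightarrow> s - 1 < n"
      using that(1) n by linarith
    show "t s x \<in> cube n" "t s (t s x) = x" "syndrome r n (t s x) = syndrome r n x XOR s"
      using that(2) s flip_in_cube flip_flip syndrome_flip[of x n "s - 1"] col[OF that(1)]
      by (auto simp: t_def)
  qed
  have "bij_betw (\<lambda>(s, x). t s x) ({..<2 ^ r} \<times> C) (cube n)"
  \<comment> \<open>Decoding: the syndrome of a vertex names the move that leads back to its
    codeword.\<close>
  proof (rule bij_betw_byWitness[where f' = "\<lambda>x. (syndrome r n x, t (syndrome r n x) x)"])
    show "\<forall>a\<in>{..<2 ^ r} \<times> C. (\<lambda>x. (syndrome r n x, t (syndrome r n x) x)) ((\<lambda>(s, x). t s x) a) = a"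
      using t by (auto simp: C_def)
    show "\<forall>x\<in>cube n. (\<lambda>(s, x). t s x) (syndrome r n x, t (syndrome r n x) x) = x"
      using t syndrome_less[OF r] by auto
    show "(\<lambda>(s, x). t s x) ` ({..<2 ^ r} \<times> C) \<subseteq> cube n"
      using t by (auto simp: C_def)
    show "(\<lambda>x. (syndrome r n x, t (syndrome r n x) x)) ` cube n \<subseteq> {..<2 ^ r} \<times> C"
      using t syndrome_less[OF r] by (auto simp: C_def)
  qed
  from bij_betw_same_card[OF this] show ?thesis
    by (simp add: card_cartesian_product card_cube C_def)
qed

section \<open>The saturated subgraph\<close>

text \<open>By \<open>rk\<close>, the coordinates with pairwise distinct columns lie among the first
  \<open>k\<close>.\<close>

locale hamming =
  fixes r k n :: nat
  assumes r: "r \<ge> 1" and rk: "2 ^ r \<le> k + 1" and kn: "k \<le> n"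
begin

abbreviation syn :: "(nat \<Rightarrow> nat) \<Rightarrow> nat" where
  "syn \<equiv> syndrome r n"

text \<open>Directions of the edges kept at \<open>x\<close>. The condition treats \<open>x\<close>
  and \<open>flip i x\<close> alike, so both ends agree on whether their edge survives.\<close>

definition dirs :: "(nat \<Rightarrow> nat) \<Rightarrow> nat set" where
  "dirs x = {i. i < k \<and> \<not> (i < 2 ^ r - 1 \<and> (syn x = 0 \<or> syn (flip i x) = 0))}"

definition pruned :: "(nat \<Rightarrow> nat) graph" where
  "pruned = \<lparr>verts = cube n, edges = {{x, flip i x} |x i. x \<in> cube n \<and> i \<in> dirs x}\<rparr>"

lemma dirs_less: "i \<in> dirs x \<Longrightarrow> i < n"
  using kn by (auto simp: dirs_def)

lemma dirs_flip: "x \<in> cube n \<Longrightarrow> i \<in> dirs x \<Longrightarrow> i \<in> dirs (flip i x)"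
  using dirs_less[of i x] flip_flip by (auto simp: dirs_def)

lemma subgraph_pruned: "subgraph pruned (hypercube n)"
proof -
  have "edges pruned \<subseteq> edges (hypercube n)"
    using dirs_less unfolding edges_hypercube pruned_def by auto
  moreover have "verts pruned = verts (hypercube n)"
    by (simp add: pruned_def hypercube_def cube_def)
  ultimately show ?thesis
    using simple_graph_hypercube[of n] by (auto simp: subgraph_def simple_graph_def)
qed

lemma simple_graph_pruned: "simple_graph pruned"
  using subgraph_pruned by (simp add: subgraph_def)

lemma neighbours_pruned:
  assumes "x \<in> cube n"
  shows "neighbours pruned x = (\<lambda>i. flip i x) ` dirs x"
proof (intro equalityI subsetI)
  fix y assume "y \<in> neighbours pruned x"
  then obtain z i where z: "z \<in> cube n" and i: "i \<in> dirs z" and "{x, y} = {z, flip i z}"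
    by (auto simp: neighbours_def pruned_def)
  then consider "x = z" "y = flip i z" | "x = flip i z" "y = z"
    by (auto simp: doubleton_eq_iff)
  then show "y \<in> (\<lambda>i. flip i x) ` dirs x"
  proof cases
    case 2
    then have "y = flip i x" "i \<in> dirs x"
      using flip_flip[OF z dirs_less[OF i]] dirs_flip[OF z i] by auto
    then show ?thesis by blast
  qed (use i in auto)
next
  fix y assume "y \<in> (\<lambda>i. flip i x) ` dirs x"
  then show "y \<in> neighbours pruned x"
    using assms by (auto simp: neighbours_def pruned_def)
qed

text \<open>Among the first \<open>k\<close> directions, a codeword loses all
  \<open>2 ^ r - 1\<close> Hamming directions, any other vertex just the one leading to a
  codeword.\<close>

lemma card_neighbours_pruned:
  assumes x: "x \<in> cube n"
  shows "card (neighbours pruned x) = (if syn x = 0 then k + 1 - 2 ^ r else k - 1)"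
proof -
  have "inj_on (\<lambda>i. flip i x) (dirs x)"
    using flip_inject[OF x] dirs_less by (auto simp: inj_on_def)
  then have "card (neighbours pruned x) = card (dirs x)"
    by (simp add: neighbours_pruned[OF x] card_image)
  also have "\<dots> = (if syn x = 0 then k + 1 - 2 ^ r else k - 1)"
  proof (cases "syn x = 0")
    case True
    then have "dirs x = {2 ^ r - 1..<k}"
      by (auto simp: dirs_def)
    then show ?thesis
      using True by simp
  next
    case False
    have "syn x - 1 < 2 ^ r - 1"
      using syndrome_less[OF r x] False by linarith
    \<comment> \<open>Here column \<open>i\<close> is \<open>i + 1\<close>, so only direction
      \<open>syn x - 1\<close> clears the syndrome.\<close>
    moreover have "syn (flip i x) = 0 \<longleftrightarrow> i = syn x - 1" if "i < 2 ^ r - 1" "i < k" for i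
      using that False kn syndrome_flip_eq_0_iff[OF x, of i r] by (auto simp: column_def)
    ultimately have "dirs x = {..<k} - {syn x - 1}" "syn x - 1 < k"
      using False rk by (auto simp: dirs_def simp del: neq0_conv)
    then show ?thesis
      using False by simp
  qed
  finally show ?thesis .
qed

lemma two_le_power_r: "(2 :: nat) \<le> 2 ^ r"
  using r power_increasing[of 1 r "2 :: nat"] by simp

lemma saturated_pruned: "saturated (hypercube n) (star k) pruned"
  unfolding saturated_def
proof (intro conjI ballI)
  have k: "k \<ge> 1"
    using two_le_power_r rk by linarith
  show "subgraph pruned (hypercube n)"
    by (rule subgraph_pruned)
  show "\<not> contains_copy pruned (star k)"
  proof
    assume "contains_copy pruned (star k)"
    then obtain x where "x \<in> cube n" "k \<le> card (neighbours pruned x)"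
      using contains_star_imp_degree[OF _ _ simple_graph_pruned] finite_cube
      by (auto simp: pruned_def)
    then show False
      using card_neighbours_pruned[of x] two_le_power_r k by (auto split: if_splits)
  qed
  fix e assume e: "e \<in> edges (hypercube n) - edges pruned"
  then obtain x i where x: "x \<in> cube n" and i: "i < n" and exi: "e = {x, flip i x}"
    by (auto simp: edges_hypercube)
  \<comment> \<open>Two adjacent codewords would force a zero column.\<close>
  have ne: "syn x \<noteq> 0 \<or> syn (flip i x) \<noteq> 0"
    using syndrome_flip_eq_0_iff[OF x i, of r] column_neq_0[of r i] by auto
  obtain u w where u: "u \<in> cube n" and uw: "e = {u, w}" and syn: "syn u \<noteq> 0"
    using ne x flip_in_cube[OF x i] exi by (metis insert_commute)
  have simple: "simple_graph (add_edge e pruned)"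
    using simple_graph_pruned e simple_graph_hypercube[of n]
    by (auto simp: simple_graph_def add_edge_def)
  have "w \<notin> neighbours pruned u"
    using e uw by (auto simp: neighbours_def)
  moreover have fin: "finite (neighbours G v)" if "simple_graph G" "finite (verts G)" for G v
    using neighbours_subset_verts[OF that(1)] that(2) by (rule finite_subset)
  \<comment> \<open>The degree \<open>k - 1\<close> of the non-codeword \<open>u\<close> grows by
    one because \<open>w\<close> is a new neighbour.\<close>
  ultimately have "card (insert w (neighbours pruned u)) = k"
    using card_neighbours_pruned[OF u] syn k fin[OF simple_graph_pruned] finite_cube
    by (simp add: pruned_def)
  moreover have "insert w (neighbours pruned u) \<subseteq> neighbours (add_edge e pruned) u"
    using uw by (auto simp: neighbours_def add_edge_def)
  moreover have "finite (neighbours (add_edge e pruned) u)"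
    using fin[OF simple] finite_cube uw by (simp add: add_edge_def pruned_def)
  ultimately have "k \<le> card (neighbours (add_edge e pruned) u)"
    by (metis card_mono)
  then show "contains_copy (add_edge e pruned) (star k)"
    using u by (intro contains_star_if_degree[OF simple]) (auto simp: add_edge_def pruned_def)
qed

lemma card_edges_pruned:
  "real (card (edges pruned)) = (real k - 2 + 2 / 2 ^ r) * 2 ^ (n - 1)"
proof -
  define c where "c = card {x \<in> cube n. syn x = 0}"
  have "n \<ge> 1" "k \<ge> 1"
    using two_le_power_r rk kn by linarith+
  have "2 ^ r - 1 \<le> n"
    using rk kn by linarith
  from card_code[OF r this] have "real (2 ^ r * c) = real (2 ^ n)"
    unfolding c_def by presburger
  then have c: "real c = 2 ^ n / 2 ^ r"
    by (simp add: field_simps)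
  have "2 * real (card (edges pruned)) = (\<Sum>x\<in>cube n. real (card (neighbours pruned x)))"
    using handshake[OF simple_graph_pruned] finite_cube
    by (simp add: pruned_def flip: of_nat_sum)
  \<comment> \<open>Degrees are written as \<open>k - 1\<close> minus the deficit
    \<open>2 ^ r - 2\<close> at codewords, so that the sum needs only the number of
    codewords.\<close>
  also have "\<dots> = (\<Sum>x\<in>cube n. (real k - 1) - (if syn x = 0 then 2 ^ r - 2 else 0))"
    using rk \<open>k \<ge> 1\<close> by (intro sum.cong) (auto simp: card_neighbours_pruned of_nat_diff)
  also have "\<dots> = (real k - 1) * 2 ^ n - real c * (2 ^ r - 2)"
    by (simp add: sum_subtractf card_cube c_def sum.If_cases finite_cube Int_def)
  also have "\<dots> = (real k - 2 + 2 / 2 ^ r) * 2 ^ n"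
    unfolding c by (simp add: field_simps)
  also have "(2 :: real) ^ n = 2 * 2 ^ (n - 1)"
    using \<open>n \<ge> 1\<close> by (cases n) auto
  finally show ?thesis
    by simp
qed

end

theorem theorem11:
  shows "\<exists>\<epsilon> :: nat \<Rightarrow> real. \<epsilon> \<longlonglongrightarrow> 0 \<and>
    (\<forall>k n. k \<ge> 1 \<and> n \<ge> k \<longrightarrow>
      real (sat (hypercube n) (star k)) \<le> (real k - 2 + \<epsilon> k) * 2 ^ (n - 1))"
proof (intro exI[of _ "\<lambda>k. 4 / real (Suc k)"] conjI allI impI)
  show "(\<lambda>k. 4 / real (Suc k)) \<longlonglongrightarrow> 0"
    using tendsto_mult_right_zero[OF LIMSEQ_inverse_real_of_nat, of 4] by (simp add: divide_inverse)
  fix k n :: nat assume kn: "k \<ge> 1 \<and> n \<ge> k"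
  \<comment> \<open>The largest possible \<open>r\<close> is taken: \<open>2 ^ (r + 1)\<close>
    exceeding \<open>k + 1\<close> turns the error \<open>2 / 2 ^ r\<close> into at most
    \<open>4 / (k + 1)\<close>.\<close>
  then obtain r where bounds: "2 ^ r \<le> k + 1" "k + 1 < 2 ^ (r + 1)"
    using ex_power_ivl1[of 2 "k + 1"] by auto
  \<comment> \<open>For \<open>r = 0\<close> the upper bound would read \<open>k + 1 < 2\<close>,
    contrary to \<open>k \<ge> 1\<close>.\<close>
  have "r \<ge> 1"
    using bounds kn by (cases r) auto
  then interpret hamming r k n
    using bounds kn by unfold_locales auto
  have "real (k + 1) < real (2 ^ (r + 1))"
    using bounds(2) of_nat_less_iff by blast
  then have "2 / 2 ^ r \<le> 4 / real (Suc k)"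
    by (simp add: field_simps)
  then have "(real k - 2 + 2 / 2 ^ r) * 2 ^ (n - 1) \<le> (real k - 2 + 4 / real (Suc k)) * 2 ^ (n - 1)"
    by (intro mult_right_mono) auto
  moreover have "real (sat (hypercube n) (star k)) \<le> real (card (edges pruned))"
    using sat_le[OF saturated_pruned] by simp
  ultimately show "real (sat (hypercube n) (star k)) \<le> (real k - 2 + 4 / real (Suc k)) * 2 ^ (n - 1)"
    using card_edges_pruned by linarith
qed

end
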